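(* Assume that $\mathfrak d$ is regular. Then there is an ultrafilter $\mathcal U$ with $\mathfrak b(\mathcal U)=\mathfrak d$, and a $\mathfrak b(\mathcal U)$-scale $S=\{f_\alpha:\alpha<\mathfrak d\}$, such that all finite powers of the set $X=S\cup Q$ (viewed as a subspace of $\overline{\mathbb N}^{\uparrow\mathbb N}$) satisfy $\mathbf B(\mathcal U)$, but $X$ does not have the Hurewicz property.
   Context: $\mathbb N=\{0,1,2,\dots\}$, discrete; $\mathbb N^{\mathbb N}$ has the product topology. $[\mathbb N]^{\aleph_0}$ is the family of infinite subsets of $\mathbb N$; $A\subseteq^*B$ means $A\setminus B$ is finite. A semifilter is a nonempty $\mathcal F\subseteq[\mathbb N]^{\aleph_0}$ such that $A\in\mathcal F$, $B\subseteq\mathbb N$ and $A\subseteq^*B$ imply $B\in\mathcal F$. A filter is a semifilter closed under finite intersections; an ultrafilter is a maximal filter (so all its elements are infinite, i.e. it is nonprincipal). For $f,g\in\mathbb N^{\mathbb N}$, $f\le_{\mathcal F}g$ means $\{n:f(n)\le g(n)\}\in\mathcal F$, and $f\le^*g$ means $f(n)\le g(n)$ for all but finitely many $n$. A set $Y\subseteq\mathbb N^{\mathbb N}$ is bounded with respect to such a relation $R$ if there is $g\in\mathbb N^{\mathbb N}$ with $f\,R\,g$ for all $f\in Y$; otherwise it is unbounded. $\mathfrak b(\mathcal F)$ is the minimal cardinality of a subset of $\mathbb N^{\mathbb N}$ unbounded with respect to $\le_{\mathcal F}$; $\mathfrak d$ is the minimal cardinality of a dominating family, i.e. of a $D\subseteq\mathbb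 N^{\mathbb N}$ such that each $g\in\mathbb N^{\mathbb N}$ satisfies $g\le^*f$ for some $f\in D$. A space satisfies $\mathbf B(\mathcal F)$ if each of its continuous images in $\mathbb N^{\mathbb N}$ is bounded with respect to $\le_{\mathcal F}$; it has the Hurewicz property if each of its continuous images in $\mathbb N^{\mathbb N}$ is bounded with respect to $\le^*$. $\mathbb N^{\uparrow\mathbb N}$ is the set of (strictly) increasing elements of $\mathbb N^{\mathbb N}$. A $\mathfrak b(\mathcal F)$-scale is a family $S=\{f_\alpha:\alpha<\mathfrak b(\mathcal F)\}\subseteq\mathbb N^{\uparrow\mathbb N}$ that is unbounded with respect to $\le_{\mathcal F}$ and satisfies $f_\alpha\le_{\mathcal F}f_\beta$ for all $\alpha<\beta<\mathfrak b(\mathcal F)$. $\overline{\mathbb N}=\mathbb N\cup\{\infty\}$ is the one-point compactification of $\mathbb N$. $\overline{\mathbb N}^{\uparrow\mathbb N}$ is the subspace of the product $\overline{\mathbb N}^{\mathbb N}$ consisting of the nondecreasing $f$ such that $f(n)<f(n+1)$ whenever $f(n)<\infty$. $Q$ is the (countable) set of all $f\in\overline{\mathbb N}^{\uparrow\mathbb N}$ that take the value $\infty$; thus $\overline{\mathbb N}^{\uparrow\mathbb N}=Q\cup\mathbb N^{\uparrow\mathbb N}$. *)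

theory Defs
  imports "HOL-Analysis.Analysis"
begin

no_notation elt_set_eq (infix \<open>=o\<close> 50)
unbundle cardinal_syntax

section \<open>Families of infinite sets of natural numbers\<close>

definition almost_subset :: "nat set \<Rightarrow> nat set \<Rightarrow> bool" (infix \<open>\<subseteq>\<^sup>*\<close> 50) where
  "A \<subseteq>\<^sup>* B \<longleftrightarrow> finite (A - B)"

definition semifilter :: "nat set set \<Rightarrow> bool" where
  "semifilter F \<longleftrightarrow>
     F \<noteq> {} \<and> (\<forall>A\<in>F. infinite A) \<and> (\<forall>A B. A \<in> F \<and> A \<subseteq>\<^sup>* B \<longrightarrow> B \<in> F)"

definition set_filter :: "nat set set \<Rightarrow> bool" where
  "set_filter F \<longleftrightarrow> semifilter F \<and> (\<forall>A\<in>F. \<forall>B\<in>F. A \<inter> B \<in> F)"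

definition set_ultrafilter :: "nat set set \<Rightarrow> bool" where
  "set_ultrafilter U \<longleftrightarrow> set_filter U \<and> (\<forall>F. set_filter F \<and> U \<subseteq> F \<longrightarrow> F = U)"

section \<open>Boundedness and cardinal characteristics\<close>

definition le_mod :: "nat set set \<Rightarrow> (nat \<Rightarrow> nat) \<Rightarrow> (nat \<Rightarrow> nat) \<Rightarrow> bool" where
  "le_mod F f g \<longleftrightarrow> {n. f n \<le> g n} \<in> F"

definition le_star :: "(nat \<Rightarrow> nat) \<Rightarrow> (nat \<Rightarrow> nat) \<Rightarrow> bool" where
  "le_star f g \<longleftrightarrow> (\<forall>\<^sub>\<infinity>n. f n \<le> g n)"

definition bounded_wrt ::
    "((nat \<Rightarrow> nat) \<Rightarrow> (nat \<Rightarrow> nat) \<Rightarrow> bool) \<Rightarrow> (nat \<Rightarrow> nat) set \<Rightarrow> bool" where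
  "bounded_wrt R Y \<longleftrightarrow> (\<exists>g. \<forall>f\<in>Y. R f g)"

definition dominating :: "(nat \<Rightarrow> nat) set \<Rightarrow> bool" where
  "dominating D \<longleftrightarrow> (\<forall>g. \<exists>f\<in>D. le_star g f)"

text \<open>
  Cardinals are well-order relations satisfying \<^const>\<open>Card_order\<close>, as in the library; the elements
  of the field of such a relation play the role of the ordinals below the cardinal.
  The predicate under the choice operator below depends only on the minimal cardinality, so two
  families with the same minimal cardinality get literally the same relation (see
  \<open>min_card_eq_iff\<close>).  The value is meaningful only for nonempty families of sets.
\<close>

definition min_card :: "'a set set \<Rightarrow> 'a rel" where
  "min_card \<Y> = (SOME r. Card_order r \<and> (\<exists>Y\<in>\<Y>. r =o |Y| ) \<and> (\<forall>Y\<in>\<Y>. r \<le>o |Y| ))"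

definition frak_b :: "nat set set \<Rightarrow> (nat \<Rightarrow> nat) rel" where
  "frak_b F = min_card {Y. \<not> bounded_wrt (le_mod F) Y}"

definition frak_d :: "(nat \<Rightarrow> nat) rel" where
  "frak_d = min_card {D. dominating D}"

lemma min_card:
  assumes "\<Y> \<noteq> {}"
  shows "Card_order (min_card \<Y>)"
    and "\<exists>Y\<in>\<Y>. min_card \<Y> =o |Y|"
    and "\<And>Y. Y \<in> \<Y> \<Longrightarrow> min_card \<Y> \<le>o |Y|"
proof -
  obtain Y where "Y \<in> \<Y>" "\<forall>r' \<in> card_of ` \<Y>. |Y| \<le>o r'"
    using exists_minim_Card_order[of "card_of ` \<Y>"] assms card_of_Card_order by blast
  then have "Card_order |Y| \<and> (\<exists>Z\<in>\<Y>. |Y| =o |Z| ) \<and> (\<forall>Z\<in>\<Y>. |Y| \<le>o |Z| )"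
    using card_of_Card_order[of Y] card_of_refl[of Y] by blast
  then have "\<exists>r :: 'a rel. Card_order r \<and> (\<exists>Y\<in>\<Y>. r =o |Y| ) \<and> (\<forall>Y\<in>\<Y>. r \<le>o |Y| )"
    by (rule exI)
  then have *: "Card_order (min_card \<Y>) \<and> (\<exists>Y\<in>\<Y>. min_card \<Y> =o |Y| )
      \<and> (\<forall>Y\<in>\<Y>. min_card \<Y> \<le>o |Y| )"
    unfolding min_card_def by (rule someI_ex)
  then show "Card_order (min_card \<Y>)" "\<exists>Y\<in>\<Y>. min_card \<Y> =o |Y|"
    "\<And>Y. Y \<in> \<Y> \<Longrightarrow> min_card \<Y> \<le>o |Y|"
    by auto
qed

lemma min_card_eq_iff:
  assumes "\<Y> \<noteq> {}" "\<Z> \<noteq> {}"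
  shows "min_card \<Y> = min_card \<Z> \<longleftrightarrow> min_card \<Y> =o min_card \<Z>"
proof
  assume "min_card \<Y> = min_card \<Z>"
  then show "min_card \<Y> =o min_card \<Z>"
    using ordIso_refl[OF min_card(1)[OF assms(1)]] by simp
next
  have char: "Card_order r \<and> (\<exists>Y\<in>\<X>. r =o |Y| ) \<and> (\<forall>Y\<in>\<X>. r \<le>o |Y| ) \<longleftrightarrow> r =o min_card \<X>"
    if "\<X> \<noteq> {}" for r :: "'a rel" and \<X> :: "'a set set"
  proof
    assume r: "Card_order r \<and> (\<exists>Y\<in>\<X>. r =o |Y| ) \<and> (\<forall>Y\<in>\<X>. r \<le>o |Y| )"
    then have "r \<le>o min_card \<X>"
      using min_card(2)[OF that] by (meson ordIso_symmetric ordLeq_ordIso_trans)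
    moreover have "min_card \<X> \<le>o r"
      using r min_card(3)[OF that] by (meson ordIso_symmetric ordLeq_ordIso_trans)
    ultimately show "r =o min_card \<X>"
      by (simp add: ordIso_iff_ordLeq)
  next
    assume r: "r =o min_card \<X>"
    then have "Card_order r"
      using min_card(1)[OF that] Card_order_ordIso by blast
    then show "Card_order r \<and> (\<exists>Y\<in>\<X>. r =o |Y| ) \<and> (\<forall>Y\<in>\<X>. r \<le>o |Y| )"
      using ordIso_transitive[OF r] ordIso_ordLeq_trans[OF r] min_card(2,3)[OF that] by blast
  qed
  assume eq: "min_card \<Y> =o min_card \<Z>"
  have "r =o min_card \<Y> \<longleftrightarrow> r =o min_card \<Z>" for r :: "'a rel"
    using eq by (meson ordIso_symmetric ordIso_transitive)
  then have "(Card_order r \<and> (\<exists>Y\<in>\<Y>. r =o |Y| ) \<and> (\<forall>Y\<in>\<Y>. r \<le>o |Y| )) \<longleftrightarrow>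
      (Card_order r \<and> (\<exists>Y\<in>\<Z>. r =o |Y| ) \<and> (\<forall>Y\<in>\<Z>. r \<le>o |Y| ))" for r :: "'a rel"
    by (simp only: char[OF assms(1)] char[OF assms(2)])
  then show "min_card \<Y> = min_card \<Z>"
    by (simp only: min_card_def)
qed

definition b_scale :: "nat set set \<Rightarrow> ((nat \<Rightarrow> nat) \<Rightarrow> (nat \<Rightarrow> nat)) \<Rightarrow> bool" where
  "b_scale F f \<longleftrightarrow>
     (\<forall>\<alpha>\<in>Field (frak_b F). strict_mono (f \<alpha>)) \<and>
     \<not> bounded_wrt (le_mod F) (f ` Field (frak_b F)) \<and>
     (\<forall>\<alpha> \<beta>. (\<alpha>, \<beta>) \<in> frak_b F \<and> \<alpha> \<noteq> \<beta> \<longrightarrow> le_mod F (f \<alpha>) (f \<beta>))"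

section \<open>Covering properties of spaces\<close>

definition Baire_space :: "(nat \<Rightarrow> nat) topology" where
  "Baire_space = product_topology (\<lambda>_. discrete_topology UNIV) UNIV"

definition B_property :: "nat set set \<Rightarrow> 'a topology \<Rightarrow> bool" where
  "B_property F T \<longleftrightarrow>
     (\<forall>h. continuous_map T Baire_space h \<longrightarrow> bounded_wrt (le_mod F) (h ` topspace T))"

definition Hurewicz :: "'a topology \<Rightarrow> bool" where
  "Hurewicz T \<longleftrightarrow>
     (\<forall>h. continuous_map T Baire_space h \<longrightarrow> bounded_wrt le_star (h ` topspace T))"

definition finite_power :: "'a topology \<Rightarrow> nat \<Rightarrow> (nat \<Rightarrow> 'a) topology" where
  "finite_power T k = product_topology (\<lambda>_. T) {..<k}"

section \<open>Increasing sequences in the one-point compactification\<close>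

text \<open>
  The one-point compactification of the discrete natural numbers is \<^typ>\<open>enat\<close> with its order
  topology:
\<close>

lemma enat_one_point_compactification:
  "homeomorphic_map (Alexandroff_compactification (discrete_topology (UNIV :: nat set)))
     (euclidean :: enat topology) (case_option \<infinity> enat)"
proof (rule continuous_imp_homeomorphic_map)
  let ?A = "Alexandroff_compactification (discrete_topology (UNIV :: nat set))"
  let ?h = "case_option \<infinity> enat :: nat option \<Rightarrow> enat"
  show "compact_space ?A" by simp
  show "Hausdorff_space (euclidean :: enat topology)"
    unfolding Hausdorff_space_def disjnt_def using hausdorff by fastforce
  show "?h ` topspace ?A = topspace (euclidean :: enat topology)"
  proof -
    have "y \<in> ?h ` UNIV" for y :: enat
    proof (cases y)
      case (enat n)
      then show ?thesis by (intro image_eqI[of _ _ "Some n"]) auto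
    next
      case infinity
      then show ?thesis by (intro image_eqI[of _ _ None]) auto
    qed
    then have "range ?h = UNIV" by blast
    moreover have "topspace ?A = UNIV"
      by (auto simp: UNIV_option_conv)
    ultimately show ?thesis by simp
  qed
  show "inj_on ?h (topspace ?A)"
    by (auto simp: inj_on_def split: option.splits)
  show "continuous_map ?A euclidean ?h"
    unfolding continuous_map_def
  proof (intro conjI allI impI)
    fix V :: "enat set"
    assume "openin euclidean V"
    then have V: "\<infinity> \<in> V \<longrightarrow> (\<exists>n::nat. {enat n<..} \<subseteq> V)"
      using open_enat_iff[of V] by auto
    have eq: "{x \<in> topspace ?A. ?h x \<in> V} =
        (if \<infinity> \<in> V then insert None (Some ` (UNIV - {n. enat n \<notin> V})) else Some ` {n. enat n \<in> V})"
      by (rule set_eqI, rename_tac x, case_tac x) (auto simp: image_iff)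
    show "openin ?A {x \<in> topspace ?A. ?h x \<in> V}"
    proof (cases "\<infinity> \<in> V")
      case True
      then obtain n where n: "{enat n<..} \<subseteq> V" using V by blast
      then have "{m. enat m \<notin> V} \<subseteq> {..n}"
        by (force simp: not_le)
      then have "finite {m. enat m \<notin> V}"
        using finite_subset by blast
      then show ?thesis
        unfolding eq openin_Alexandroff_compactification using True
        by (auto intro!: exI[of _ "{m. enat m \<notin> V}"] simp: compactin_discrete_topology)
    next
      case False
      then show ?thesis
        unfolding eq openin_Alexandroff_compactification by auto
    qed
  qed auto
qed

definition Nbar_up :: "(nat \<Rightarrow> enat) set" where
  "Nbar_up = {f. mono f \<and> (\<forall>n. f n < \<infinity> \<longrightarrow> f n < f (Suc n))}"

definition Nbar_up_space :: "(nat \<Rightarrow> enat) topology" where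
  "Nbar_up_space = subtopology (product_topology (\<lambda>_. euclidean) UNIV) Nbar_up"

definition Q_set :: "(nat \<Rightarrow> enat) set" where
  "Q_set = {f \<in> Nbar_up. \<exists>n. f n = \<infinity>}"

definition seq_enat :: "(nat \<Rightarrow> nat) \<Rightarrow> (nat \<Rightarrow> enat)" where
  "seq_enat f = (\<lambda>n. enat (f n))"

lemma Nbar_up_eq: "Nbar_up = Q_set \<union> seq_enat ` {f. strict_mono f}"
proof (intro subset_antisym subsetI)
  fix g assume g: "g \<in> Nbar_up"
  show "g \<in> Q_set \<union> seq_enat ` {f. strict_mono f}"
  proof (cases "\<exists>n. g n = \<infinity>")
    case True
    then show ?thesis using g by (simp add: Q_set_def)
  next
    case False
    then have ninf: "g n \<noteq> \<infinity>" for n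
      by (rule contrapos_nn) (rule exI)
    have fin: "enat (the_enat (g n)) = g n" for n
      using ninf[of n] by (cases "g n") simp_all
    have "the_enat (g n) < the_enat (g (Suc n))" for n
    proof -
      have "g n < \<infinity>"
        using ninf[of n] by simp
      then have "g n < g (Suc n)"
        using g unfolding Nbar_up_def by blast
      then have "enat (the_enat (g n)) < enat (the_enat (g (Suc n)))"
        by (simp only: fin)
      then show ?thesis by simp
    qed
    then have "strict_mono (\<lambda>n. the_enat (g n))"
      by (simp add: strict_mono_Suc_iff)
    moreover have "g = seq_enat (\<lambda>n. the_enat (g n))"
      unfolding seq_enat_def fin ..
    ultimately show ?thesis by blast
  qed
next
  fix g assume "g \<in> Q_set \<union> seq_enat ` {f. strict_mono f}"
  then consider "g \<in> Q_set" | f where "strict_mono f" "g = seq_enat f"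
    by blast
  then show "g \<in> Nbar_up"
  proof cases
    case 1
    then show ?thesis by (simp add: Q_set_def)
  next
    case 2
    have "mono g"
      unfolding 2(2) seq_enat_def using strict_mono_mono[OF 2(1)] by (simp add: mono_def)
    moreover have "g n < g (Suc n)" for n
      unfolding 2(2) seq_enat_def using strict_monoD[OF 2(1), of n "Suc n"] by simp
    ultimately show ?thesis by (simp add: Nbar_up_def)
  qed
qed

definition X_space :: "(nat \<Rightarrow> nat) set \<Rightarrow> (nat \<Rightarrow> enat) topology" where
  "X_space S = subtopology Nbar_up_space (seq_enat ` S \<union> Q_set)"

end

theory Submission
  imports Defs
begin

text \<open>
  The scale is built by transfinite recursion along \<^term>\<open>frak_d\<close>, together with an enumeration
  \<open>e\<close> of a dominating family.  At stage \<open>\<alpha>\<close> fewer than \<open>d\<close> functions are prescribed, so some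
  \<open>f \<alpha>\<close> is not dominated by any of them; this keeps all finite intersections of the sets
  \<open>{n. e \<beta> n \<le> f \<alpha> n \<and> f \<beta> n \<le> f \<alpha> n}\<close>, \<open>\<beta> < \<alpha>\<close>, infinite, and any ultrafilter \<open>U\<close> containing
  these sets makes \<open>f\<close> increasing and cofinal modulo \<open>U\<close>.  Regularity of \<open>d\<close> gives \<open>b(U) = d\<close>.

  If \<open>h\<close> is continuous on a finite power of \<open>X\<close>, compactness yields a \<open>g\<close> such that \<open>h x n \<le> g n\<close>
  whenever all entries of \<open>x\<close> are at least \<open>g n\<close> at \<open>n\<close>.  All but fewer than \<open>b(U)\<close> elements of
  the scale are above \<open>g\<close> modulo \<open>U\<close>; tuples with an exceptional entry are handled by induction on
  the exponent.

  Finally \<open>f \<alpha>\<close> can be chosen so that its range has infinite complement but contains the interval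
  \<open>{n..e \<alpha> n}\<close> for infinitely many \<open>n\<close>.  The function sending \<open>x\<close> and \<open>n\<close> to the first number
  from \<open>n\<close> on outside the range of \<open>x\<close> is then continuous on \<open>X\<close>, with unbounded image.
\<close>

section \<open>Cardinal arithmetic\<close>

text \<open>Inserting one element of \<open>A\<close> into the sets with at most \<open>n\<close>
  elements yields all nonempty sets with at most \<open>n + 1\<close>. So each level
  \<open>F n\<close> has size at most \<open>|A|\<close>, and \<open>Fpow A\<close> is a countable
  union of levels.\<close>

lemma card_of_Fpow_ordLeq_infinite:
  assumes "infinite A"
  shows "|Fpow A| \<le>o |A|"
proof -
  define F where "F n = {X. X \<subseteq> A \<and> finite X \<and> card X \<le> n}" for n
  have "|F n| \<le>o |A|" for n
  proof (induction n)
    case 0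
    have "F 0 = {{}}" by (auto simp: F_def)
    then show ?case
      using assms by (metis card_of_singl_ordLeq finite.emptyI)
  next
    case (Suc n)
    have "X \<in> {{}} \<union> (\<lambda>(a, X). insert a X) ` (A \<times> F n)" if "X \<in> F (Suc n)" for X
    proof (cases "X = {}")
      case False
      then obtain a where "a \<in> X" by blast
      then have "X = insert a (X - {a})" "a \<in> A" "X - {a} \<in> F n"
        using that by (auto simp: F_def)
      then have "X \<in> (\<lambda>(a, X). insert a X) ` (A \<times> F n)"
        by (intro image_eqI[where x = "(a, X - {a})"]) auto
      then show ?thesis by blast
    qed simp
    then have "F (Suc n) \<subseteq> {{}} \<union> (\<lambda>(a, X). insert a X) ` (A \<times> F n)" by blast
    then have "|F (Suc n)| \<le>o |{{}} \<union> (\<lambda>(a, X). insert a X) ` (A \<times> F n)|"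
      by (rule card_of_mono1)
    moreover have "|{{}} \<union> (\<lambda>(a, X). insert a X) ` (A \<times> F n)| \<le>o |A|"
    proof (rule card_of_Un_ordLeq_infinite_Field)
      show "infinite (Field |A| )" using assms by (simp add: Field_card_of)
      show "|{{}}| \<le>o |A|" using assms by (metis card_of_singl_ordLeq finite.emptyI)
      have "|A \<times> F n| \<le>o |A|"
        using assms Suc by (intro card_of_Times_ordLeq_infinite_Field)
          (auto simp: Field_card_of card_of_card_order_on card_of_refl ordIso_imp_ordLeq)
      then show "|(\<lambda>(a, X). insert a X) ` (A \<times> F n)| \<le>o |A|"
        using card_of_image ordLeq_transitive by blast
    qed (rule card_of_Card_order)
    ultimately show ?case using ordLeq_transitive by blast
  qed
  then have "|\<Union>n. F n| \<le>o |A|"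
    using assms infinite_iff_card_of_nat by (intro card_of_UNION_ordLeq_infinite) auto
  moreover have "Fpow A = (\<Union>n. F n)"
    by (auto simp: Fpow_def F_def)
  ultimately show ?thesis by simp
qed

lemma card_of_finite_ordLess:
  assumes "finite A" "Card_order r" "infinite (Field r)"
  shows "|A| <o r"
  using assms card_of_Well_order[of A] by (intro finite_ordLess_infinite)
    (auto simp: Field_card_of card_order_on_well_order_on)

lemma card_of_Fpow_ordLess:
  assumes "Card_order r" "infinite (Field r)" "|A| <o r"
  shows "|Fpow A| <o r"
proof (cases "finite A")
  case True
  then have "finite (Fpow A)"
    by (simp add: Fpow_def)
  then show ?thesis using assms card_of_finite_ordLess by blast
next
  case False
  then show ?thesis
    using card_of_Fpow_ordLeq_infinite assms(3) ordLeq_ordLess_trans by blast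
qed

section \<open>The dominating number\<close>

lemma le_star_trans: "le_star f g \<Longrightarrow> le_star g h \<Longrightarrow> le_star f h"
  unfolding le_star_def by (elim MOST_rev_mp) (simp add: order_trans)

lemma dominating_UNIV: "dominating UNIV"
  unfolding dominating_def le_star_def by (metis UNIV_I always_eventually order_refl)

lemma Card_order_frak_d: "Card_order frak_d"
  unfolding frak_d_def using dominating_UNIV by (intro min_card(1)) auto

lemma not_dominating:
  assumes "|D| <o frak_d"
  shows "\<not> dominating D"
  using assms min_card(3)[of "{D. dominating D}" D] not_ordLess_ordLeq
  unfolding frak_d_def by blast

lemma dominating_indexed_by_frak_d: "\<exists>e. dominating (e ` Field frak_d)"
proof -
  obtain D where D: "dominating D" "frak_d =o |D|"
    using min_card(2)[of "{D. dominating D}"] dominating_UNIV unfolding frak_d_def by auto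
  then have "|Field frak_d| =o |D|"
    using card_of_Field_ordIso[OF Card_order_frak_d] ordIso_transitive by blast
  then obtain e where "bij_betw e (Field frak_d) D"
    using card_of_ordIso by blast
  then show ?thesis using D by (metis bij_betw_imp_surj_on)
qed

text \<open>One more than the pointwise sum of a finite family exceeds every member everywhere, so a
  finite family cannot dominate.\<close>

lemma infinite_Field_frak_d: "infinite (Field frak_d)"
proof
  assume fin: "finite (Field frak_d)"
  obtain e where e: "dominating (e ` Field frak_d)"
    using dominating_indexed_by_frak_d by blast
  define g where "g n = Suc (\<Sum>\<alpha>\<in>Field frak_d. e \<alpha> n)" for n
  have "e \<alpha> n < g n" if "\<alpha> \<in> Field frak_d" for \<alpha> n
    using member_le_sum[OF that, of "\<lambda>\<alpha>. e \<alpha> n"] fin by (simp add: g_def)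
  then show False
    using e unfolding dominating_def le_star_def
    by (metis (mono_tags, lifting) MOST_const image_iff leD MOST_mono infinite_UNIV_nat)
qed

text \<open>Summing up to \<open>n\<close> makes the result nondecreasing; the extra
  \<open>Suc n\<close> puts it strictly above both \<open>n\<close> and \<open>f n\<close>.\<close>

definition majorant :: "(nat \<Rightarrow> nat) \<Rightarrow> nat \<Rightarrow> nat" where
  "majorant f n = Suc n + (\<Sum>i\<le>n. f i)"

lemma le_majorant: "f n \<le> majorant f n"
  unfolding majorant_def using member_le_sum[of n "{..n}" f] by simp

lemma less_majorant: "n < majorant f n"
  unfolding majorant_def by simp

lemma mono_majorant: "mono (majorant f)"
  unfolding majorant_def by (intro monoI add_mono sum_mono2) auto

lemma gap_majorant: "{n..f n} \<subseteq> {n..<majorant f n}"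
  using member_le_sum[of n "{..n}" f] by (auto simp: majorant_def)

text \<open>
  The range of the function is a union of intervals \<open>[p\<^sub>n, q\<^sub>n)\<close>, where \<open>q\<^sub>n\<close> is computed from \<open>p\<^sub>n\<close>
  by \<open>D\<close> and \<open>p\<^sub>n\<^sub>+\<^sub>1\<close> is computed from \<open>q\<^sub>n\<close> by a \<open>g\<close> that is not dominated by the functions
  \<open>\<phi> \<circ> D \<circ> \<phi>\<close>, for (majorants of) the given \<open>\<phi>\<close> and \<open>D\<close>.
\<close>
lemma undominated_with_gaps:
  fixes \<Phi> :: "(nat \<Rightarrow> nat) set" and D :: "nat \<Rightarrow> nat"
  assumes "|\<Phi>| <o frak_d"
  shows "\<exists>f. strict_mono f \<and> infinite (- range f) \<and> (\<forall>\<phi>\<in>\<Phi>. \<exists>\<^sub>\<infinity>n. \<phi> n < f n) \<and>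
    (\<exists>\<^sub>\<infinity>n. {n..D n} \<subseteq> range f)"
proof -
  define D' where "D' = majorant D"
  define \<Psi> where "\<Psi> = (\<lambda>\<phi>. majorant \<phi> \<circ> D' \<circ> majorant \<phi>) ` \<Phi>"
  have "|\<Psi>| <o frak_d"
    unfolding \<Psi>_def using assms card_of_image ordLeq_ordLess_trans by blast
  then obtain g0 where g0: "\<And>\<psi>. \<psi> \<in> \<Psi> \<Longrightarrow> \<not> le_star g0 \<psi>"
    using not_dominating unfolding dominating_def by blast
  define g where "g = majorant g0"
  have g: "\<exists>\<^sub>\<infinity>n. majorant \<phi> (D' (majorant \<phi> n)) < g n" if "\<phi> \<in> \<Phi>" for \<phi>
  proof (rule ccontr)
    assume "\<not> ?thesis"
    then have "\<forall>\<^sub>\<infinity>n. g n \<le> majorant \<phi> (D' (majorant \<phi> n))"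
      by (simp add: not_INFM not_less)
    then have "le_star g0 (majorant \<phi> \<circ> D' \<circ> majorant \<phi>)"
      unfolding le_star_def
      by (rule MOST_mono) (use le_majorant[of g0] in \<open>auto simp: g_def intro: order_trans\<close>)
    then show False using g0 that by (auto simp: \<Psi>_def)
  qed
  define p where "p n = ((\<lambda>x. g (D' x)) ^^ n) 0" for n
  define q where "q n = D' (p n)" for n
  have pSuc: "p (Suc n) = g (q n)" for n by (simp add: p_def q_def)
  have pq: "p n < q n" for n by (simp add: q_def D'_def less_majorant)
  have qp: "q n < p (Suc n)" for n by (simp add: pSuc g_def less_majorant)
  have q_mono: "strict_mono q"
    using less_trans[OF qp pq] by (simp add: strict_mono_Suc_iff)
  have p_mono: "strict_mono p"
    using less_trans[OF pq qp] by (simp add: strict_mono_Suc_iff)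
  define A where "A = (\<Union>n. {p n..<q n})"
  define f where "f = enumerate A"
  have "infinite (range p)"
    using p_mono by (simp add: range_inj_infinite strict_mono_imp_inj_on)
  moreover have "range p \<subseteq> A" using pq by (auto simp: A_def)
  ultimately have infA: "infinite A" using infinite_super by blast
  have range_f: "range f = A" unfolding f_def by (rule range_enumerate[OF infA])
  have strict_f: "strict_mono f" unfolding f_def by (rule strict_mono_enumerate[OF infA])
  have gap: "x \<notin> A" if x: "q n \<le> x" "x < p (Suc n)" for x n
  proof
    assume "x \<in> A"
    then obtain m where m: "p m \<le> x" "x < q m" by (auto simp: A_def)
    then have "n < m" using x strict_mono_less[OF q_mono, of n m] by linarith
    moreover have "m < Suc n" using m x strict_mono_less[OF p_mono, of m "Suc n"] by linarith
    ultimately show False by simp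
  qed
  have "range q \<subseteq> - range f"
    using gap qp unfolding range_f by blast
  moreover have "infinite (range q)"
    using q_mono by (simp add: range_inj_infinite strict_mono_imp_inj_on)
  ultimately have coinf: "infinite (- range f)" using infinite_super by blast
  \<comment> \<open>If \<open>f (q n)\<close> stayed below \<open>p (Suc n)\<close>, all values of
    \<open>f\<close> at arguments up to \<open>q n\<close> would miss the gap starting at
    \<open>q n\<close> and so lie below \<open>q n\<close>, against
    \<open>q n \<le> f (q n)\<close>.\<close>
  have f_large: "p (Suc n) \<le> f (q n)" for n
  proof (rule ccontr)
    assume *: "\<not> ?thesis"
    have "f i < q n" if "i \<le> q n" for i
    proof -
      have "f i \<le> f (q n)" using that strict_f by (simp add: strict_mono_less_eq)
      then have "f i < p (Suc n)" using * by linarith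
      then show ?thesis using gap[of n "f i"] range_f by (metis not_le rangeI)
    qed
    then show False
      using strict_mono_imp_increasing[OF strict_f, of "q n"] by (metis leD order_refl)
  qed
  have "\<exists>\<^sub>\<infinity>n. \<phi> n < f n" if \<phi>: "\<phi> \<in> \<Phi>" for \<phi>
  proof (rule ccontr)
    assume "\<not> ?thesis"
    then obtain N where N: "\<And>n. n \<ge> N \<Longrightarrow> f n \<le> \<phi> n"
      by (auto simp: not_INFM not_less MOST_nat_le)
    define \<psi> where "\<psi> = majorant \<phi>"
    have \<psi>: "p (Suc n) \<le> \<psi> (q n)" if "n \<ge> N" for n
    proof -
      have "N \<le> q n" using that strict_mono_imp_increasing[OF q_mono, of n] by linarith
      then show ?thesis
        using f_large[of n] N[of "q n"] le_majorant[of \<phi> "q n"] by (simp add: \<psi>_def)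
    qed
    have mono: "mono g" "mono \<psi>" "mono D'" by (auto simp: g_def \<psi>_def D'_def mono_majorant)
    have "g m \<le> \<psi> (D' (\<psi> m))" if m: "m \<ge> q N" for m
    proof -
      \<comment> \<open>With this \<open>n\<close>, the number \<open>m\<close> lies between
        \<open>q n\<close> and \<open>q (Suc n)\<close>. Monotonicity of \<open>g\<close> replaces
        \<open>m\<close> by \<open>q (Suc n)\<close>; two uses of the bound on \<open>p\<close>,
        with \<open>D'\<close> between them, then lead back to \<open>q n \<le> m\<close>.\<close>
      define n where "n = (LEAST n. m < q (Suc n))"
      have ex: "\<exists>n. m < q (Suc n)"
        using strict_mono_imp_increasing[OF q_mono, of "Suc m"] by (metis Suc_le_lessD)
      have n1: "m < q (Suc n)" unfolding n_def using ex by (rule LeastI_ex)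
      have nN: "N \<le> n"
        using n1 m strict_mono_less[OF q_mono, of N "Suc n"] by simp
      have n2: "q n \<le> m"
      proof (cases n)
        case 0 then show ?thesis using nN m by simp
      next
        case (Suc k)
        then have "\<not> m < q (Suc k)" using not_less_Least[of k "\<lambda>n. m < q (Suc n)"] by (simp add: n_def)
        then show ?thesis using Suc by simp
      qed
      have "g m \<le> g (q (Suc n))" using mono(1) n1 by (simp add: monoD)
      also have "\<dots> = p (Suc (Suc n))" by (simp add: pSuc)
      also have "\<dots> \<le> \<psi> (q (Suc n))" using \<psi> nN by simp
      also have "\<dots> = \<psi> (D' (p (Suc n)))" by (simp add: q_def)
      also have "\<dots> \<le> \<psi> (D' (\<psi> (q n)))" using \<psi>[OF nN] mono by (simp add: monoD)
      also have "\<dots> \<le> \<psi> (D' (\<psi> m))" using n2 mono by (simp add: monoD)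
      finally show ?thesis .
    qed
    moreover obtain m where "m > q N" "\<psi> (D' (\<psi> m)) < g m"
      using g[OF \<phi>] unfolding INFM_nat \<psi>_def by blast
    ultimately show False by (meson leD less_imp_le)
  qed
  moreover have "\<exists>\<^sub>\<infinity>n. {n..D n} \<subseteq> range f"
    unfolding INFM_nat
  proof
    fix m
    have "m < p (Suc m)" using strict_mono_imp_increasing[OF p_mono, of "Suc m"] by simp
    moreover have "{p (Suc m)..D (p (Suc m))} \<subseteq> range f"
      using gap_majorant[where n = "p (Suc m)" and f = D] unfolding range_f A_def q_def D'_def by blast
    ultimately show "\<exists>n>m. {n..D n} \<subseteq> range f" by blast
  qed
  ultimately show ?thesis using strict_f coinf by blast
qed

section \<open>Filters\<close>

lemma set_filter_mono: "set_filter F \<Longrightarrow> A \<in> F \<Longrightarrow> A \<subseteq> B \<Longrightarrow> B \<in> F"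
  unfolding set_filter_def semifilter_def almost_subset_def
  by (metis Diff_eq_empty_iff finite.emptyI)

lemma set_filter_almost_mono: "set_filter F \<Longrightarrow> A \<in> F \<Longrightarrow> finite (A - B) \<Longrightarrow> B \<in> F"
  unfolding set_filter_def semifilter_def almost_subset_def by metis

lemma set_filter_Int: "set_filter F \<Longrightarrow> A \<in> F \<Longrightarrow> B \<in> F \<Longrightarrow> A \<inter> B \<in> F"
  unfolding set_filter_def by blast

lemma set_filter_infinite: "set_filter F \<Longrightarrow> A \<in> F \<Longrightarrow> infinite A"
  unfolding set_filter_def semifilter_def by blast

lemma set_filter_cofinite:
  assumes "set_filter F" "finite (- A)"
  shows "A \<in> F"
proof -
  obtain C where "C \<in> F" using assms unfolding set_filter_def semifilter_def by blast
  moreover have "finite (C - A)" by (rule finite_subset[OF _ assms(2)]) blast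
  ultimately show ?thesis using assms set_filter_almost_mono by blast
qed

lemma set_filter_INT:
  assumes "set_filter F" "finite I" "\<And>i. i \<in> I \<Longrightarrow> A i \<in> F"
  shows "(\<Inter>i\<in>I. A i) \<in> F"
  using assms(2,3)
  by (induction I) (auto intro: set_filter_Int[OF assms(1)] set_filter_cofinite[OF assms(1)])

text \<open>The sets almost containing a finite intersection of members of \<open>B\<close> form a
  filter, so Zorn's lemma applies to the filters containing \<open>B\<close>. A maximal one among
  these is maximal outright, since every larger filter contains \<open>B\<close> as well.\<close>

lemma ex_ultrafilter:
  assumes centred: "\<And>E. finite E \<Longrightarrow> E \<subseteq> B \<Longrightarrow> infinite (\<Inter>E)"
  shows "\<exists>U. set_ultrafilter U \<and> B \<subseteq> U"
proof -
  define F0 where "F0 = {A. \<exists>E. finite E \<and> E \<subseteq> B \<and> finite (\<Inter>E - A)}"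
  have "set_filter F0"
    unfolding set_filter_def semifilter_def
  proof (intro conjI ballI allI impI)
    have "UNIV \<in> F0" unfolding F0_def by (auto intro: exI[of _ "{}"])
    then show "F0 \<noteq> {}" by blast
  next
    fix A assume "A \<in> F0"
    then obtain E where E: "finite E" "E \<subseteq> B" "finite (\<Inter>E - A)" unfolding F0_def by blast
    then show "infinite A" using centred finite_Diff2[of A "\<Inter>E"] by blast
  next
    fix A C assume *: "A \<in> F0 \<and> A \<subseteq>\<^sup>* C"
    then obtain E where E: "finite E" "E \<subseteq> B" "finite (\<Inter>E - A)" unfolding F0_def by blast
    have "\<Inter>E - C \<subseteq> (\<Inter>E - A) \<union> (A - C)" by blast
    then have "finite (\<Inter>E - C)"
      using E * unfolding almost_subset_def by (meson finite_UnI finite_subset)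
    then show "C \<in> F0" using E unfolding F0_def by blast
  next
    fix A C assume "A \<in> F0" "C \<in> F0"
    then obtain E E' where E: "finite E" "E \<subseteq> B" "finite (\<Inter>E - A)"
      and E': "finite E'" "E' \<subseteq> B" "finite (\<Inter>E' - C)" unfolding F0_def by blast
    have "\<Inter>(E \<union> E') - A \<inter> C \<subseteq> (\<Inter>E - A) \<union> (\<Inter>E' - C)" by blast
    then have "finite (\<Inter>(E \<union> E') - A \<inter> C)"
      using E E' by (meson finite_UnI finite_subset)
    then show "A \<inter> C \<in> F0" using E E' unfolding F0_def by blast
  qed
  moreover have "B \<subseteq> F0"
  proof
    fix A assume "A \<in> B"
    then show "A \<in> F0" unfolding F0_def by (auto intro!: exI[of _ "{A}"])
  qed
  ultimately have ne: "{F. set_filter F \<and> B \<subseteq> F} \<noteq> {}" by blast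
  have "\<exists>U\<in>{F. set_filter F \<and> B \<subseteq> F}. \<forall>F\<in>{F. set_filter F \<and> B \<subseteq> F}. U \<subseteq> F \<longrightarrow> F = U"
  proof (rule subset_Zorn_nonempty[OF ne])
    fix \<C> assume \<C>: "\<C> \<noteq> {}" "subset.chain {F. set_filter F \<and> B \<subseteq> F} \<C>"
    have filt: "set_filter F" "B \<subseteq> F" if "F \<in> \<C>" for F
      using \<C>(2) that unfolding subset.chain_def by auto
    have total: "F \<subseteq> G \<or> G \<subseteq> F" if "F \<in> \<C>" "G \<in> \<C>" for F G
      using \<C>(2) that by (simp add: subset_chain_def)
    have "set_filter (\<Union>\<C>)"
      unfolding set_filter_def semifilter_def
    proof (intro conjI ballI allI impI)
      obtain F where "F \<in> \<C>" using \<C>(1) by blast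
      then show "\<Union>\<C> \<noteq> {}"
        using filt(1) unfolding set_filter_def semifilter_def by (metis UnionI ex_in_conv)
    next
      fix A assume "A \<in> \<Union>\<C>"
      then obtain F where "F \<in> \<C>" "A \<in> F" by (rule UnionE)
      then show "infinite A" using filt(1) set_filter_infinite by metis
    next
      fix A C assume *: "A \<in> \<Union>\<C> \<and> A \<subseteq>\<^sup>* C"
      then obtain F where F: "F \<in> \<C>" "A \<in> F" by (metis UnionE)
      then have "C \<in> F"
        using * filt(1) set_filter_almost_mono unfolding almost_subset_def by metis
      then show "C \<in> \<Union>\<C>" using F(1) by (rule UnionI[rotated])
    next
      fix A C assume "A \<in> \<Union>\<C>" "C \<in> \<Union>\<C>"
      then obtain F G where "F \<in> \<C>" "A \<in> F" "G \<in> \<C>" "C \<in> G" by (metis UnionE)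
      then obtain F where F: "F \<in> \<C>" "A \<in> F" "C \<in> F" using total by (metis subsetD)
      then have "A \<inter> C \<in> F" using filt(1) set_filter_Int by metis
      then show "A \<inter> C \<in> \<Union>\<C>" using F(1) by (rule UnionI[rotated])
    qed
    moreover obtain F where "F \<in> \<C>" using \<C>(1) by blast
    then have "B \<subseteq> \<Union>\<C>" using filt(2) by (metis Union_upper subset_trans)
    ultimately show "\<Union>\<C> \<in> {F. set_filter F \<and> B \<subseteq> F}" by simp
  qed
  then obtain U where U: "set_filter U" "B \<subseteq> U"
    "\<forall>F\<in>{F. set_filter F \<and> B \<subseteq> F}. U \<subseteq> F \<longrightarrow> F = U" by auto
  have "F = U" if "set_filter F" "U \<subseteq> F" for F
    using U(2,3) that subset_trans[OF U(2) that(2)] by simp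
  then show ?thesis using U(1,2) unfolding set_ultrafilter_def by metis
qed

section \<open>The order modulo a filter\<close>

lemma le_mod_trans:
  assumes "set_filter F" "le_mod F f g" "le_mod F g h"
  shows "le_mod F f h"
proof -
  have "{n. f n \<le> g n} \<inter> {n. g n \<le> h n} \<in> F"
    using assms set_filter_Int unfolding le_mod_def by blast
  then show ?thesis
    unfolding le_mod_def by (rule set_filter_mono[OF assms(1)]) auto
qed

lemma le_mod_pointwise: "set_filter F \<Longrightarrow> (\<And>n. f n \<le> g n) \<Longrightarrow> le_mod F f g"
  unfolding le_mod_def using set_filter_cofinite[of F UNIV] by simp

lemma le_star_imp_le_mod: "set_filter F \<Longrightarrow> le_star f g \<Longrightarrow> le_mod F f g"
  unfolding le_mod_def le_star_def
  by (rule set_filter_cofinite) (auto simp: MOST_iff_cofinite Collect_neg_eq)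

lemma bounded_wrt_le_mod:
  assumes "|Y| <o frak_b F"
  shows "bounded_wrt (le_mod F) Y"
proof (rule ccontr)
  assume "\<not> ?thesis"
  then have "frak_b F \<le>o |Y|"
    unfolding frak_b_def by (intro min_card(3)) auto
  then show False using assms not_ordLess_ordLeq by blast
qed

section \<open>The scale\<close>

text \<open>For finite \<open>H\<close>, a finite intersection of the sets that the ultrafilter has
  to contain. It is antitone in \<open>H\<close>, so finitely many of these sets all include the one
  for the union of their index sets.\<close>

definition joint_bound ::
    "'i rel \<Rightarrow> ('i \<Rightarrow> nat \<Rightarrow> nat) \<Rightarrow> ('i \<Rightarrow> nat \<Rightarrow> nat) \<Rightarrow> 'i set \<Rightarrow> nat set" where
  "joint_bound r e f H =
     {n. \<forall>\<beta>\<in>H. \<forall>\<gamma>\<in>H. (\<beta>, \<gamma>) \<in> r \<and> \<beta> \<noteq> \<gamma> \<longrightarrow> e \<beta> n \<le> f \<gamma> n \<and> f \<beta> n \<le> f \<gamma> n}"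

lemma joint_bound_cong: "(\<And>\<beta>. \<beta> \<in> H \<Longrightarrow> f \<beta> = g \<beta>) \<Longrightarrow> joint_bound r e f H = joint_bound r e g H"
  unfolding joint_bound_def by auto

text \<open>
  An increasing function exceeding \<open>\<phi>\<close> at \<open>n\<close> exceeds \<open>h \<beta>\<close> at the first element of \<open>A\<close> after \<open>n\<close>,
  if \<open>\<phi> n\<close> is the value there of a bound of the \<open>h \<beta>\<close>.
\<close>
lemma undominated_step:
  fixes A :: "'i set \<Rightarrow> nat set" and h :: "'i \<Rightarrow> nat \<Rightarrow> nat"
  assumes "|L| <o frak_d"
  shows "\<exists>f. strict_mono f \<and> infinite (- range f) \<and> (\<exists>\<^sub>\<infinity>n. {n..D n} \<subseteq> range f) \<and>
    (\<forall>H. finite H \<and> H \<subseteq> L \<and> infinite (A H) \<longrightarrow> infinite {n \<in> A H. \<forall>\<beta>\<in>H. h \<beta> n \<le> f n})"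
proof -
  define next_in where "next_in H n = (LEAST m. n \<le> m \<and> m \<in> A H)" for H n
  define \<phi> where "\<phi> H n = (\<Sum>\<beta>\<in>H. h \<beta> (next_in H n))" for H n
  \<comment> \<open>There are still fewer than d finite subsets of \<open>L\<close>, so one function
    can escape all the \<open>\<phi> H\<close> at once.\<close>
  have "|Fpow L| <o frak_d"
    using card_of_Fpow_ordLess[OF Card_order_frak_d infinite_Field_frak_d assms] .
  then have "|\<phi> ` Fpow L| <o frak_d"
    using card_of_image ordLeq_ordLess_trans by blast
  from undominated_with_gaps[OF this, of D] obtain f
    where f: "strict_mono f" "infinite (- range f)" "\<exists>\<^sub>\<infinity>n. {n..D n} \<subseteq> range f"
      and f_large: "\<And>H. H \<in> Fpow L \<Longrightarrow> \<exists>\<^sub>\<infinity>n. \<phi> H n < f n"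
    by blast
  have "infinite {n \<in> A H. \<forall>\<beta>\<in>H. h \<beta> n \<le> f n}" if H: "finite H" "H \<subseteq> L" "infinite (A H)" for H
    unfolding infinite_nat_iff_unbounded_le
  proof
    fix m
    obtain n where n: "m < n" "\<phi> H n < f n"
      using f_large[of H] H unfolding Fpow_def INFM_nat by blast
    have "\<exists>m. n \<le> m \<and> m \<in> A H"
      using H(3) unfolding infinite_nat_iff_unbounded_le by blast
    then have k: "n \<le> next_in H n" "next_in H n \<in> A H"
      unfolding next_in_def by (metis (mono_tags, lifting) LeastI_ex)+
    have "h \<beta> (next_in H n) \<le> f (next_in H n)" if "\<beta> \<in> H" for \<beta>
    proof -
      have "h \<beta> (next_in H n) \<le> \<phi> H n"
        unfolding \<phi>_def using that H(1) by (intro member_le_sum) auto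
      also have "\<dots> \<le> f (next_in H n)"
        using n(2) k(1) f(1) by (meson less_imp_le order_trans strict_mono_less_eq)
      finally show ?thesis .
    qed
    then show "\<exists>n\<ge>m. n \<in> {n \<in> A H. \<forall>\<beta>\<in>H. h \<beta> n \<le> f n}"
      using n(1) k by (intro exI[of _ "next_in H n"]) auto
  qed
  then show ?thesis using f by blast
qed

lemma finite_has_greatest:
  assumes "Linear_order r" "finite H" "H \<noteq> {}" "H \<subseteq> Field r"
  shows "\<exists>\<alpha>\<in>H. \<forall>\<beta>\<in>H. (\<beta>, \<alpha>) \<in> r"
  using assms(2-4)
proof (induction H rule: finite_ne_induct)
  case (singleton x)
  then show ?case
    using assms(1) by (auto simp: order_on_defs refl_on_def)
next
  case (insert x H)
  then obtain \<alpha> where \<alpha>: "\<alpha> \<in> H" "\<forall>\<beta>\<in>H. (\<beta>, \<alpha>) \<in> r" by auto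
  have refl: "(x, x) \<in> r" using insert.prems assms(1) by (auto simp: order_on_defs refl_on_def)
  have trans: "trans r" using assms(1) by (auto simp: order_on_defs)
  have "total_on (Field r) r" using assms(1) by (auto simp: order_on_defs)
  then have "(x, \<alpha>) \<in> r \<or> (\<alpha>, x) \<in> r"
    using insert.prems \<alpha>(1) refl by (cases "x = \<alpha>") (auto simp: total_on_def subset_iff)
  then show ?case
  proof
    assume "(x, \<alpha>) \<in> r"
    then show ?thesis using \<alpha> by auto
  next
    assume "(\<alpha>, x) \<in> r"
    then have "(\<beta>, x) \<in> r" if "\<beta> \<in> H" for \<beta>
      using \<alpha>(2) that transD[OF trans] by blast
    then show ?thesis using refl by auto
  qed
qed

text \<open>Recursion along the well-order picks \<open>f \<alpha>\<close> by
  \<open>undominated_step\<close>. Infinitude follows by induction on \<open>H\<close>: the greatest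
  index \<open>\<alpha>\<close> is removed, and \<open>f \<alpha>\<close> was chosen to lie above
  the remaining \<open>e \<beta>\<close> and \<open>f \<beta>\<close> at infinitely many places of
  their joint bound.\<close>

lemma ex_scale:
  fixes e :: "(nat \<Rightarrow> nat) \<Rightarrow> nat \<Rightarrow> nat"
  shows "\<exists>f. (\<forall>\<alpha>. strict_mono (f \<alpha>) \<and> infinite (- range (f \<alpha>)) \<and>
      (\<exists>\<^sub>\<infinity>n. {n..e \<alpha> n} \<subseteq> range (f \<alpha>))) \<and>
    (\<forall>H. finite H \<and> H \<subseteq> Field frak_d \<longrightarrow> infinite (joint_bound frak_d e f H))"
proof -
  define r where "r = frak_d"
  have wo: "Well_order r"
    using Card_order_frak_d by (simp add: r_def card_order_on_well_order_on)
  then have lin: "Linear_order r" and wf: "wf (r - Id)"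
    by (auto simp: well_order_on_def)
  have trans: "trans r" and antisym: "antisym r"
    using lin by (auto simp: order_on_defs)
  \<comment> \<open>\<open>P f \<alpha> x\<close> makes \<open>x\<close> an admissible value at
    \<open>\<alpha>\<close>, given the earlier values of \<open>f\<close>. Infinitude of the joint
    bound is a premise inside it, so that a value exists for arbitrary \<open>f\<close>; the final
    induction supplies it.\<close>
  define P where "P f \<alpha> x \<longleftrightarrow> strict_mono x \<and> infinite (- range x) \<and>
      (\<exists>\<^sub>\<infinity>n. {n..e \<alpha> n} \<subseteq> range x) \<and>
      (\<forall>H. finite H \<and> H \<subseteq> underS r \<alpha> \<and> infinite (joint_bound r e f H) \<longrightarrow>
        infinite {n \<in> joint_bound r e f H. \<forall>\<beta>\<in>H. max (e \<beta> n) (f \<beta> n) \<le> x n})"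
    for f :: "(nat \<Rightarrow> nat) \<Rightarrow> nat \<Rightarrow> nat" and \<alpha> and x :: "nat \<Rightarrow> nat"
  have "\<exists>f. \<forall>\<alpha>. P f \<alpha> (f \<alpha>)"
  proof (rule dependent_wf_choice[OF wf])
    fix f g :: "(nat \<Rightarrow> nat) \<Rightarrow> nat \<Rightarrow> nat" and \<alpha> x assume "\<And>\<beta>. (\<beta>, \<alpha>) \<in> r - Id \<Longrightarrow> f \<beta> = g \<beta>"
    then have eq: "f \<beta> = g \<beta>" if "\<beta> \<in> underS r \<alpha>" for \<beta>
      using that by (auto simp: underS_def)
    have "joint_bound r e f H = joint_bound r e g H" if "H \<subseteq> underS r \<alpha>" for H
      using eq that by (intro joint_bound_cong) auto
    moreover have "{n \<in> joint_bound r e g H. \<forall>\<beta>\<in>H. max (e \<beta> n) (f \<beta> n) \<le> x n} =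
        {n \<in> joint_bound r e g H. \<forall>\<beta>\<in>H. max (e \<beta> n) (g \<beta> n) \<le> x n}"
      if "H \<subseteq> underS r \<alpha>" for H
      by (intro Collect_cong conj_cong refl ball_cong) (use eq that in auto)
    ultimately show "P f \<alpha> x = P g \<alpha> x"
      unfolding P_def by (simp cong: conj_cong)
  next
    fix \<alpha> and f :: "(nat \<Rightarrow> nat) \<Rightarrow> nat \<Rightarrow> nat"
    \<comment> \<open>The recursion runs over the whole type; indices outside the field have no
      predecessors.\<close>
    have "|underS r \<alpha>| <o frak_d"
    proof (cases "\<alpha> \<in> Field r")
      case True
      then show ?thesis unfolding r_def by (rule card_of_underS[OF Card_order_frak_d])
    next
      case False
      then have "underS r \<alpha> = {}" by (auto simp: underS_def Field_def)
      then show ?thesis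
        using card_of_finite_ordLess[OF _ Card_order_frak_d infinite_Field_frak_d]
        by (metis finite.emptyI)
    qed
    \<comment> \<open>Here \<open>A\<close> is \<open>joint_bound r e f\<close>, \<open>D\<close> is
      \<open>e \<alpha>\<close>, and \<open>h \<beta>\<close> is the pointwise maximum of
      \<open>e \<beta>\<close> and \<open>f \<beta>\<close>.\<close>
    then show "\<exists>x. P f \<alpha> x" unfolding P_def by (rule undominated_step)
  qed
  then obtain f where f: "\<And>\<alpha>. P f \<alpha> (f \<alpha>)" by blast
  have "infinite (joint_bound r e f H)" if "finite H" "H \<subseteq> Field r" for H
    using that
  proof (induction H rule: finite_psubset_induct)
    case (psubset H)
    show ?case
    proof (cases "H = {}")
      case True
      then show ?thesis by (simp add: joint_bound_def)
    next
      case False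
      then obtain \<alpha> where \<alpha>: "\<alpha> \<in> H" "\<forall>\<beta>\<in>H. (\<beta>, \<alpha>) \<in> r"
        using finite_has_greatest[OF lin psubset.hyps _ psubset.prems] by blast
      define H' where "H' = H - {\<alpha>}"
      have "infinite (joint_bound r e f H')"
        unfolding H'_def by (rule psubset.IH) (use \<alpha> psubset.prems in auto)
      moreover have "H' \<subseteq> underS r \<alpha>" using \<alpha> by (auto simp: H'_def underS_def)
      ultimately have "infinite {n \<in> joint_bound r e f H'. \<forall>\<beta>\<in>H'. max (e \<beta> n) (f \<beta> n) \<le> f \<alpha> n}"
        using f[of \<alpha>] psubset.hyps unfolding P_def H'_def by blast
      moreover have "{n \<in> joint_bound r e f H'. \<forall>\<beta>\<in>H'. max (e \<beta> n) (f \<beta> n) \<le> f \<alpha> n}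
          \<subseteq> joint_bound r e f H"
      proof (intro subsetI)
        fix n assume n: "n \<in> {n \<in> joint_bound r e f H'. \<forall>\<beta>\<in>H'. max (e \<beta> n) (f \<beta> n) \<le> f \<alpha> n}"
        have "e \<beta> n \<le> f \<gamma> n \<and> f \<beta> n \<le> f \<gamma> n"
          if "\<beta> \<in> H" "\<gamma> \<in> H" "(\<beta>, \<gamma>) \<in> r" "\<beta> \<noteq> \<gamma>" for \<beta> \<gamma>
        proof -
          have "\<beta> \<in> H'"
            using that \<alpha> antisym unfolding H'_def by (metis Diff_iff antisymD singletonD)
          then show ?thesis
            using n that by (cases "\<gamma> = \<alpha>") (auto simp: H'_def joint_bound_def)
        qed
        then show "n \<in> joint_bound r e f H" unfolding joint_bound_def by blast
      qed
      ultimately show ?thesis using infinite_super by blast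
    qed
  qed
  then show ?thesis using f unfolding P_def r_def by blast
qed

section \<open>Continuous images of powers\<close>

lemma compact_space_enat: "compact_space (euclidean :: enat topology)"
  using homeomorphic_compact_space[OF homeomorphic_map_imp_homeomorphic_space[OF
    enat_one_point_compactification]] by simp

lemma open_enat_atLeast: "open {enat m..}"
  unfolding open_enat_iff by (intro impI exI[of _ m]) auto

lemma openin_enat_coordinate:
  "openin Nbar_up_space {x \<in> Nbar_up. x n = enat m}"
proof -
  have "openin (product_topology (\<lambda>_. euclidean) UNIV)
      {x \<in> topspace (product_topology (\<lambda>_. euclidean) UNIV). x n \<in> {enat m}}"
    by (intro openin_continuous_map_preimage[OF continuous_map_product_projection]) (auto simp: open_enat)
  then show ?thesis
    unfolding Nbar_up_space_def openin_subtopology by (intro exI conjI) auto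
qed

lemma topspace_Nbar_up_space: "topspace Nbar_up_space = Nbar_up"
  unfolding Nbar_up_space_def by simp

text \<open>Every violation of the defining conditions is witnessed by a finite value
  \<open>x (Suc n) = enat m\<close>. As \<open>{enat m}\<close> and \<open>{enat m..}\<close> are
  open, violations are open conditions, which makes \<open>Nbar_up\<close> closed in the
  product.\<close>

lemma Nbar_up_iff: "x \<in> Nbar_up \<longleftrightarrow> (\<forall>n m. \<not> (x (Suc n) = enat m \<and> enat m \<le> x n))"
proof
  assume x: "x \<in> Nbar_up"
  show "\<forall>n m. \<not> (x (Suc n) = enat m \<and> enat m \<le> x n)"
  proof (intro allI notI)
    fix n m assume *: "x (Suc n) = enat m \<and> enat m \<le> x n"
    have "x n \<le> x (Suc n)" using x unfolding Nbar_up_def by (auto intro: monoD)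
    then have "x n < \<infinity>" using * by (cases "x n") auto
    then have "x n < x (Suc n)" using x unfolding Nbar_up_def by blast
    then show False using * by auto
  qed
next
  assume x: "\<forall>n m. \<not> (x (Suc n) = enat m \<and> enat m \<le> x n)"
  have step: "x (Suc n) = \<infinity> \<or> x n < x (Suc n)" for n
    using x by (cases "x (Suc n)") (auto simp: not_le)
  have "x n \<le> x (Suc n)" for n using step[of n] by auto
  then have "mono x" by (simp add: mono_iff_le_Suc)
  moreover have "x n < x (Suc n)" if "x n < \<infinity>" for n using step[of n] that by auto
  ultimately show "x \<in> Nbar_up" unfolding Nbar_up_def by blast
qed

lemma compact_space_Nbar_up: "compact_space Nbar_up_space"
proof -
  let ?T = "product_topology (\<lambda>_::nat. euclidean :: enat topology) UNIV"
  have coord: "openin ?T {x. x n \<in> U}" if "open U" for n U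
    using openin_continuous_map_preimage[OF continuous_map_product_projection[of n UNIV], of "\<lambda>_. euclidean" U]
      that by simp
  have "openin ?T (\<Union>n m. {x. x (Suc n) \<in> {enat m}} \<inter> {x. x n \<in> {enat m..}})"
    by (intro openin_Union ballI) (auto intro!: openin_Union openin_Int
        coord[of "{enat m}" for m, simplified] coord[of "{enat m..}" for m, simplified]
        open_enat open_enat_atLeast)
  moreover have "(\<Union>n m. {x. x (Suc n) \<in> {enat m}} \<inter> {x. x n \<in> {enat m..}}) = UNIV - Nbar_up"
    by (auto simp: Nbar_up_iff)
  ultimately have "closedin ?T Nbar_up" unfolding closedin_def by simp
  moreover have "compact_space ?T"
    by (simp add: compact_space_product_topology compact_space_enat)
  ultimately show ?thesis
    unfolding Nbar_up_space_def by (intro compact_space_subtopology closedin_compact_space)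
qed

lemma le_Nbar_up: "x \<in> Nbar_up \<Longrightarrow> enat n \<le> x n"
proof (induction n)
  case 0
  then show ?case by (simp add: zero_enat_def[symmetric])
next
  case (Suc n)
  then have *: "enat n \<le> x n" by simp
  show ?case
  proof (cases "x (Suc n)")
    case (enat m)
    then have "x n < enat m" using Suc.prems unfolding Nbar_up_iff by (meson not_le)
    then show ?thesis using * enat by (metis Suc_ile_eq le_less_trans)
  qed simp
qed

lemma Q_set_infinity:
  assumes "x \<in> Q_set"
  shows "\<exists>N. \<forall>n\<ge>N. x n = \<infinity>"
proof -
  obtain N where N: "mono x" "x N = \<infinity>" using assms by (auto simp: Q_set_def Nbar_up_def)
  then have "x n = \<infinity>" if "n \<ge> N" for n using monoD[OF N(1) that] by simp
  then show ?thesis by blast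
qed

lemma seq_enat_Nbar_up: "strict_mono f \<Longrightarrow> seq_enat f \<in> Nbar_up"
  unfolding Nbar_up_eq by blast

lemma topspace_X_space:
  assumes "\<And>s. s \<in> S \<Longrightarrow> strict_mono s"
  shows "topspace (X_space S) = seq_enat ` S \<union> Q_set"
  using assms seq_enat_Nbar_up unfolding X_space_def
  by (auto simp: topspace_Nbar_up_space Q_set_def)

lemma continuous_map_Baire_space_iff:
  "continuous_map T Baire_space h \<longleftrightarrow> (\<forall>n v. openin T {x \<in> topspace T. h x n = v})"
proof -
  have "continuous_map T (discrete_topology UNIV) f \<longleftrightarrow> (\<forall>v. openin T {x \<in> topspace T. f x = v})"
    for f :: "'a \<Rightarrow> nat"
  proof
    assume f: "continuous_map T (discrete_topology UNIV) f"
    show "\<forall>v. openin T {x \<in> topspace T. f x = v}"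
      using openin_continuous_map_preimage[OF f, of "{v}" for v] by simp
  next
    assume f: "\<forall>v. openin T {x \<in> topspace T. f x = v}"
    have "{x \<in> topspace T. f x \<in> U} = (\<Union>v\<in>U. {x \<in> topspace T. f x = v})" for U by blast
    then show "continuous_map T (discrete_topology UNIV) f"
      unfolding continuous_map_def using f by (auto intro!: openin_Union)
  qed
  then show ?thesis
    unfolding Baire_space_def continuous_map_componentwise_UNIV by simp
qed

text \<open>
  Every point of the compact power of \<open>Nbar_up\<close> has a neighbourhood on which the claim holds: if all
  its entries are \<open>\<infinity>\<close> at \<open>n\<close>, they belong to \<open>Q_set\<close> and \<open>h\<close> is locally constant there;
  otherwise some entry is finite at \<open>n\<close> on a whole neighbourhood.
\<close>
lemma continuous_image_bound:
  assumes S: "\<And>s. s \<in> S \<Longrightarrow> strict_mono s"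
    and h: "continuous_map (product_topology (\<lambda>_. X_space S) I) Baire_space h"
  shows "\<exists>g. \<forall>x\<in>topspace (product_topology (\<lambda>_. X_space S) I).
    (\<forall>i\<in>I. enat g \<le> x i n) \<longrightarrow> h x n \<le> g"
proof -
  define P where "P = product_topology (\<lambda>_. Nbar_up_space) I"
  define T where "T = product_topology (\<lambda>_. X_space S) I"
  define X where "X = seq_enat ` S \<union> Q_set"
  have T: "T = subtopology P (\<Pi>\<^sub>E i\<in>I. X)"
    unfolding T_def P_def X_def X_space_def subtopology_product_topology ..
  have X: "X \<subseteq> Nbar_up" using S seq_enat_Nbar_up by (auto simp: X_def Q_set_def)
  have topP: "topspace P = (\<Pi>\<^sub>E i\<in>I. Nbar_up)"
    by (simp add: P_def topspace_Nbar_up_space)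
  have topT: "topspace T = (\<Pi>\<^sub>E i\<in>I. X)"
    using X by (auto simp: T topP PiE_iff)
  have TP: "topspace T \<subseteq> topspace P"
    using X by (auto simp: topP topT PiE_iff)
  have "\<exists>W b. openin P W \<and> x \<in> W \<and> (\<forall>y\<in>W \<inter> topspace T. (\<forall>i\<in>I. enat b \<le> y i n) \<longrightarrow> h y n \<le> b)"
    if x: "x \<in> topspace P" for x
  proof (cases "\<forall>i\<in>I. x i n = \<infinity>")
    case True
    have xT: "x \<in> topspace T"
      using x True unfolding topP topT X_def Q_set_def by (auto simp: PiE_iff)
    have "openin T {y \<in> topspace T. h y n = h x n}"
      using h unfolding T_def continuous_map_Baire_space_iff by blast
    then obtain W where W: "openin P W" "{y \<in> topspace T. h y n = h x n} = W \<inter> (\<Pi>\<^sub>E i\<in>I. X)"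
      unfolding T openin_subtopology by blast
    have "y \<in> W \<longleftrightarrow> h y n = h x n" if "y \<in> topspace T" for y
      using W(2) that unfolding topT by blast
    then have "x \<in> W" "\<forall>y\<in>W \<inter> topspace T. h y n \<le> h x n"
      using xT by auto
    then show ?thesis
      using W(1) by (intro exI[of _ W] exI[of _ "h x n"]) simp
  next
    case False
    then obtain i where i: "i \<in> I" "x i n \<noteq> \<infinity>" by blast
    then obtain m where m: "x i n = enat m" by auto
    have "openin P {y \<in> topspace P. y i \<in> {z \<in> Nbar_up. z n = enat m}}"
      unfolding P_def
      by (intro openin_continuous_map_preimage[OF continuous_map_product_projection[OF i(1)]]
          openin_enat_coordinate)
    moreover have "x \<in> {y \<in> topspace P. y i \<in> {z \<in> Nbar_up. z n = enat m}}"
      using x i m by (auto simp: topP)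
    \<comment> \<open>With \<open>Suc m\<close> as the bound, the premise fails at \<open>i\<close>
      throughout this neighbourhood, so the claim is vacuous there.\<close>
    ultimately show ?thesis
      using i(1) by (intro exI[of _ "{y \<in> topspace P. y i \<in> {z \<in> Nbar_up. z n = enat m}}"]
          exI[of _ "Suc m"]) force
  qed
  then obtain W b where W: "\<And>x. x \<in> topspace P \<Longrightarrow> openin P (W x) \<and> x \<in> W x"
    and b: "\<And>x y. x \<in> topspace P \<Longrightarrow> y \<in> W x \<Longrightarrow> y \<in> topspace T \<Longrightarrow> \<forall>i\<in>I. enat (b x) \<le> y i n \<Longrightarrow> h y n \<le> b x"
    by (metis IntI)
  have "compact_space P"
    by (simp add: P_def compact_space_product_topology compact_space_Nbar_up)
  moreover have "topspace P \<subseteq> \<Union>(W ` topspace P)" using W by blast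
  ultimately obtain \<F> where \<F>: "finite \<F>" "\<F> \<subseteq> W ` topspace P" "topspace P \<subseteq> \<Union>\<F>"
    using W unfolding compact_space_alt by (metis (no_types, lifting) imageE)
  obtain F where F: "F \<subseteq> topspace P" "finite F" "\<F> = W ` F"
    using finite_subset_image[OF \<F>(1,2)] by blast
  \<comment> \<open>Raising \<open>b x\<close> to a common upper bound strengthens the premise and
    weakens the conclusion of the local claim.\<close>
  define g where "g = (\<Sum>x\<in>F. b x)"
  have "h y n \<le> g" if y: "y \<in> topspace T" "\<forall>i\<in>I. enat g \<le> y i n" for y
  proof -
    have "y \<in> \<Union>\<F>" using y(1) TP \<F>(3) by blast
    then obtain x where x: "x \<in> F" "y \<in> W x" using F(3) by blast
    have bg: "b x \<le> g" unfolding g_def using x(1) F(2) by (intro member_le_sum) auto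
    then have "\<forall>i\<in>I. enat (b x) \<le> y i n" using y(2) by (metis enat_ord_simps(1) order_trans)
    then show ?thesis using b[of x y] x y(1) F(1) bg by force
  qed
  then show ?thesis unfolding T_def by blast
qed

text \<open>Arbitrary finite index sets make the deletion of a coordinate an instance of the same
  statement. Without exceptional entries, \<open>U\<close> contains the finite intersection of the
  sets where the entries are at least \<open>g\<close>, and \<open>h x\<close> is at most
  \<open>g\<close> there.\<close>

lemma B_property_power:
  assumes U: "set_filter U"
    and S: "\<And>s. s \<in> S \<Longrightarrow> strict_mono s"
    and small: "\<And>g. |{s \<in> S. \<not> le_mod U g s}| <o frak_b U"
    and "finite (I :: 'i set)"
  shows "B_property U (product_topology (\<lambda>_. X_space S) I)"
  using assms(4)
proof (induction I rule: finite_psubset_induct)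
  case (psubset I)
  let ?T = "\<lambda>I. product_topology (\<lambda>_::'i. X_space S) I"
  show ?case
    unfolding B_property_def
  proof (intro allI impI)
    fix h assume h: "continuous_map (?T I) Baire_space h"
    obtain g where g: "\<And>n x. x \<in> topspace (?T I) \<Longrightarrow> \<forall>i\<in>I. enat (g n) \<le> x i n \<Longrightarrow> h x n \<le> g n"
      using continuous_image_bound[OF S h] by metis
    define E where "E = {s \<in> S. \<not> le_mod U g s}"
    have "\<exists>G. \<forall>x\<in>topspace (?T I). \<forall>s\<in>E. x i = seq_enat s \<longrightarrow> le_mod U (h x) G" if i: "i \<in> I" for i
    proof -
      have "\<exists>G. \<forall>x\<in>topspace (?T I). x i = seq_enat s \<longrightarrow> le_mod U (h x) G" if s: "s \<in> E" for s
      proof -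
        \<comment> \<open>Inserting \<open>seq_enat s\<close> at \<open>i\<close> maps the power
          over \<open>I - {i}\<close> onto the slice \<open>x i = seq_enat s\<close>, so the
          induction hypothesis bounds \<open>h\<close> on that slice.\<close>
        define ins where "ins y = y(i := seq_enat s)" for y :: "'i \<Rightarrow> nat \<Rightarrow> enat"
        have "continuous_map (?T (I - {i})) (?T I) ins"
          unfolding continuous_map_componentwise
        proof (intro conjI ballI)
          show "ins ` topspace (?T (I - {i})) \<subseteq> extensional I"
            using i by (auto simp: ins_def PiE_iff extensional_def)
          fix j assume j: "j \<in> I"
          have "seq_enat s \<in> topspace (X_space S)"
            using s S by (auto simp: topspace_X_space E_def)
          then show "continuous_map (?T (I - {i})) (X_space S) (\<lambda>y. ins y j)"
            using j by (cases "j = i") (auto simp: ins_def intro!: continuous_map_product_projection)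
        qed
        then have "continuous_map (?T (I - {i})) Baire_space (h \<circ> ins)"
          using h continuous_map_compose by blast
        moreover have "B_property U (?T (I - {i}))"
          using i by (intro psubset.IH) blast
        ultimately obtain G where
          G: "\<forall>f\<in>(h \<circ> ins) ` topspace (?T (I - {i})). le_mod U f G"
          unfolding B_property_def bounded_wrt_def by blast
        have "le_mod U (h x) G" if x: "x \<in> topspace (?T I)" "x i = seq_enat s" for x
        proof -
          have "restrict x (I - {i}) \<in> topspace (?T (I - {i}))"
            using x(1) by (auto simp: PiE_iff)
          moreover have "ins (restrict x (I - {i})) = x"
            using x by (auto simp: ins_def PiE_iff extensional_def fun_eq_iff)
          moreover have "le_mod U ((h \<circ> ins) y) G" if "y \<in> topspace (?T (I - {i}))" for y
            using G that by blast
          ultimately show ?thesis by (metis comp_apply)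
        qed
        then show ?thesis by blast
      qed
      then obtain G where G: "\<And>s x. s \<in> E \<Longrightarrow> x \<in> topspace (?T I) \<Longrightarrow> x i = seq_enat s \<Longrightarrow>
          le_mod U (h x) (G s)"
        by metis
      \<comment> \<open>There are fewer than b(U) exceptional \<open>s\<close>, so the bounds on
        their slices have a common bound.\<close>
      have "|G ` E| <o frak_b U"
        using card_of_image small[of g] ordLeq_ordLess_trans unfolding E_def by blast
      then obtain G' where "\<forall>f\<in>G ` E. le_mod U f G'"
        using bounded_wrt_le_mod unfolding bounded_wrt_def by blast
      then show ?thesis using G le_mod_trans[OF U] by blast
    qed
    then obtain G where G: "\<And>i s x. i \<in> I \<Longrightarrow> s \<in> E \<Longrightarrow> x \<in> topspace (?T I) \<Longrightarrow> x i = seq_enat s \<Longrightarrow>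
        le_mod U (h x) (G i)"
      by metis
    define B where "B n = g n + (\<Sum>i\<in>I. G i n)" for n
    have "le_mod U (h x) B" if x: "x \<in> topspace (?T I)" for x
    proof (cases "\<exists>i\<in>I. \<exists>s\<in>E. x i = seq_enat s")
      case True
      then obtain i where i: "i \<in> I" "le_mod U (h x) (G i)" using G x by blast
      have "le_mod U (G i) B"
        using i(1) psubset.hyps member_le_sum[of i I "\<lambda>i. G i n" for n]
        by (intro le_mod_pointwise[OF U]) (simp add: B_def trans_le_add2)
      then show ?thesis using i(2) le_mod_trans[OF U] by blast
    next
      case False
      have "{n. enat (g n) \<le> x i n} \<in> U" if i: "i \<in> I" for i
      proof -
        have "x i \<in> seq_enat ` S \<union> Q_set"
          using x i topspace_X_space[OF S] by (auto simp: PiE_iff)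
        then show ?thesis
        proof
          assume "x i \<in> seq_enat ` S"
          then obtain s where s: "s \<in> S" "x i = seq_enat s" by blast
          then have "le_mod U g s" using False i by (auto simp: E_def)
          then show ?thesis using s by (simp add: le_mod_def seq_enat_def)
        next
          assume "x i \<in> Q_set"
          then obtain N where "\<And>n. N \<le> n \<Longrightarrow> x i n = \<infinity>" using Q_set_infinity by blast
          then have "- {n. enat (g n) \<le> x i n} \<subseteq> {..<N}"
            by (force simp: not_le[symmetric])
          then show ?thesis
            using set_filter_cofinite[OF U] finite_subset by blast
        qed
      qed
      then have "(\<Inter>i\<in>I. {n. enat (g n) \<le> x i n}) \<in> U"
        by (rule set_filter_INT[OF U psubset.hyps])
      then show ?thesis
        unfolding le_mod_def
      proof (rule set_filter_mono[OF U], intro subsetI CollectI)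
        fix n assume "n \<in> (\<Inter>i\<in>I. {n. enat (g n) \<le> x i n})"
        then have "h x n \<le> g n" by (intro g[OF x]) simp
        then show "h x n \<le> B n" by (simp add: B_def)
      qed
    qed
    then show "bounded_wrt (le_mod U) (h ` topspace (?T I))"
      unfolding bounded_wrt_def by blast
  qed
qed

section \<open>Failure of the Hurewicz property\<close>

definition next_gap :: "(nat \<Rightarrow> enat) \<Rightarrow> nat \<Rightarrow> nat" where
  "next_gap x n = (LEAST m. n \<le> m \<and> enat m \<notin> range x)"

text \<open>A point of \<open>Q_set\<close> is eventually \<open>\<infinity>\<close> and so takes
  only finitely many finite values; for the other points the gap comes from the coinfinite
  range.\<close>

lemma ex_gap:
  assumes S: "\<And>s. s \<in> S \<Longrightarrow> infinite (- range s)" and x: "x \<in> seq_enat ` S \<union> Q_set"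
  shows "\<exists>m\<ge>n. enat m \<notin> range x"
  using x
proof
  assume "x \<in> seq_enat ` S"
  then obtain s where s: "s \<in> S" "x = seq_enat s" by blast
  then obtain m where "m \<ge> n" "m \<notin> range s"
    using S unfolding infinite_nat_iff_unbounded_le by blast
  then show ?thesis using s by (auto simp: seq_enat_def)
next
  assume "x \<in> Q_set"
  then obtain N where N: "\<And>k. N \<le> k \<Longrightarrow> x k = \<infinity>" using Q_set_infinity by blast
  \<comment> \<open>Whatever \<open>the_enat\<close> does at \<open>\<infinity>\<close> adds at most
    one number to the finite set to be avoided.\<close>
  have "finite (the_enat ` x ` {..<N})" by simp
  then obtain m where m: "m \<ge> n" "m \<notin> the_enat ` x ` {..<N}"
    by (metis finite_nat_set_iff_bounded_le nle_le not_less_eq_eq)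
  have "enat m \<noteq> x k" for k
  proof
    assume k: "enat m = x k"
    then have "k < N" using N[of k] by (cases "k < N") auto
    moreover have "m = the_enat (x k)" using k[symmetric] by simp
    ultimately show False using m(2) by blast
  qed
  then show ?thesis using m(1) by blast
qed

text \<open>Since \<open>enat i \<le> x i\<close>, whether \<open>m\<close> occurs in
  \<open>x\<close> depends on the coordinates up to \<open>m\<close> only, and each condition
  \<open>x i = enat m\<close> is clopen. The event \<open>next_gap x n = v\<close> involves finitely
  many \<open>m\<close>.\<close>

lemma continuous_next_gap:
  assumes strict: "\<And>s. s \<in> S \<Longrightarrow> strict_mono s" and coinf: "\<And>s. s \<in> S \<Longrightarrow> infinite (- range s)"
  shows "continuous_map (X_space S) Baire_space next_gap"
  unfolding continuous_map_Baire_space_iff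
proof (intro allI)
  fix n v
  let ?T = "X_space S"
  have top: "topspace ?T = seq_enat ` S \<union> Q_set" by (rule topspace_X_space[OF strict])
  have sub: "topspace ?T \<subseteq> Nbar_up"
    unfolding X_space_def using topspace_Nbar_up_space by auto
  have coord: "openin ?T {x \<in> topspace ?T. x i = enat m}" for i m
  proof -
    have "{x \<in> topspace ?T. x i = enat m} = {x \<in> Nbar_up. x i = enat m} \<inter> (seq_enat ` S \<union> Q_set)"
      using sub top by blast
    then show ?thesis
      unfolding X_space_def openin_subtopology using openin_enat_coordinate by blast
  qed
  have coord': "openin ?T {x \<in> topspace ?T. x i \<noteq> enat m}" for i m
  proof -
    have "open (- {enat m})" unfolding open_enat_iff by (auto intro: exI[of _ m])
    then have "openin (product_topology (\<lambda>_. euclidean) UNIV) {x. x i \<in> - {enat m}}"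
      using openin_continuous_map_preimage[OF continuous_map_product_projection[of i UNIV],
        of "\<lambda>_. euclidean" "- {enat m}"] by simp
    then have "openin Nbar_up_space ({x. x i \<in> - {enat m}} \<inter> Nbar_up)"
      unfolding Nbar_up_space_def openin_subtopology by blast
    moreover have "{x \<in> topspace ?T. x i \<noteq> enat m} =
        ({x. x i \<in> - {enat m}} \<inter> Nbar_up) \<inter> (seq_enat ` S \<union> Q_set)"
      using sub top by blast
    ultimately show ?thesis
      unfolding X_space_def openin_subtopology by blast
  qed
  have in_range: "enat m \<in> range x \<longleftrightarrow> (\<exists>i\<le>m. x i = enat m)" if "x \<in> topspace ?T" for x m
    using le_Nbar_up[of x] that sub by (metis enat_ord_simps(1) rangeE rangeI subsetD)
  \<comment> \<open>For \<open>m\<close> in \<open>{n..v}\<close>, this is what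
    \<open>next_gap x n = v\<close> demands: numbers below \<open>v\<close> occur as values,
    \<open>v\<close> itself does not.\<close>
  define A where "A m = {x \<in> topspace ?T. enat m \<in> range x \<longleftrightarrow> m < v}" for m
  have "openin ?T (A m)" for m
  proof (cases "m < v")
    case True
    then have "A m = (\<Union>i\<in>{..m}. {x \<in> topspace ?T. x i = enat m})"
      using in_range by (auto simp: A_def)
    then show ?thesis using coord by auto
  next
    case False
    then have "A m = (\<Inter>i\<in>{..m}. {x \<in> topspace ?T. x i \<noteq> enat m})"
      using in_range by (auto simp: A_def)
    then show ?thesis using coord' by auto
  qed
  moreover have "{x \<in> topspace ?T. next_gap x n = v} = (if n \<le> v then \<Inter>m\<in>{n..v}. A m else {})"
  proof -
    have iff: "next_gap x n = v \<longleftrightarrow> n \<le> v \<and> enat v \<notin> range x \<and> (\<forall>m\<in>{n..<v}. enat m \<in> range x)"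
      if "x \<in> topspace ?T" for x
    proof -
      have ex: "\<exists>m. n \<le> m \<and> enat m \<notin> range x"
        by (rule ex_gap[of S]) (use coinf that top in auto)
      show ?thesis
      proof
        assume v: "next_gap x n = v"
        show "n \<le> v \<and> enat v \<notin> range x \<and> (\<forall>m\<in>{n..<v}. enat m \<in> range x)"
          using LeastI_ex[OF ex] v not_less_Least[of _ "\<lambda>m. n \<le> m \<and> enat m \<notin> range x"]
          unfolding next_gap_def by auto
      next
        assume "n \<le> v \<and> enat v \<notin> range x \<and> (\<forall>m\<in>{n..<v}. enat m \<in> range x)"
        then show "next_gap x n = v"
          unfolding next_gap_def by (intro Least_equality) (auto simp: not_less[symmetric])
      qed
    qed
    show ?thesis
    proof (cases "n \<le> v")
      case True
      then have interval: "{n..v} = insert v {n..<v}" by auto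
      have "next_gap x n = v \<longleftrightarrow> (\<forall>m\<in>{n..v}. x \<in> A m)" if "x \<in> topspace ?T" for x
        unfolding iff[OF that] interval A_def using True that by simp
      moreover have "x \<in> topspace ?T" if "\<forall>m\<in>{n..v}. x \<in> A m" for x
        using that unfolding interval by (simp add: A_def)
      ultimately have "x \<in> {x \<in> topspace ?T. next_gap x n = v} \<longleftrightarrow> x \<in> (\<Inter>m\<in>{n..v}. A m)" for x
        unfolding mem_Collect_eq INT_iff by metis
      then have "{x \<in> topspace ?T. next_gap x n = v} = (\<Inter>m\<in>{n..v}. A m)"
        by (rule set_eqI)
      then show ?thesis using True by simp
    next
      case False
      then show ?thesis using iff by auto
    qed
  qed
  ultimately show "openin ?T {x \<in> topspace ?T. next_gap x n = v}"
    by (auto intro!: openin_INT2)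
qed

text \<open>Some \<open>e \<alpha>\<close> would dominate a bound of the image, but
  \<open>next_gap\<close> of \<open>f \<alpha>\<close> exceeds \<open>e \<alpha> n\<close> whenever
  \<open>{n..e \<alpha> n}\<close> is inside the range.\<close>

lemma not_Hurewicz_gaps:
  assumes e: "dominating (e ` J)"
    and f: "\<And>\<alpha>. \<alpha> \<in> J \<Longrightarrow> strict_mono (f \<alpha>) \<and> infinite (- range (f \<alpha>)) \<and>
      (\<exists>\<^sub>\<infinity>n. {n..e \<alpha> n} \<subseteq> range (f \<alpha>))"
  shows "\<not> Hurewicz (X_space (f ` J))"
proof
  assume "Hurewicz (X_space (f ` J))"
  moreover have "continuous_map (X_space (f ` J)) Baire_space next_gap"
    using f by (intro continuous_next_gap) auto
  ultimately obtain g where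
    g: "\<And>x. x \<in> topspace (X_space (f ` J)) \<Longrightarrow> le_star (next_gap x) g"
    unfolding Hurewicz_def bounded_wrt_def by blast
  obtain \<alpha> where \<alpha>: "\<alpha> \<in> J" "le_star g (e \<alpha>)"
    using e unfolding dominating_def by blast
  have x: "seq_enat (f \<alpha>) \<in> seq_enat ` f ` J \<union> Q_set" using \<alpha>(1) by blast
  moreover have "topspace (X_space (f ` J)) = seq_enat ` f ` J \<union> Q_set"
    using f by (intro topspace_X_space) auto
  ultimately have "le_star (next_gap (seq_enat (f \<alpha>))) (e \<alpha>)"
    using g \<alpha>(2) le_star_trans by metis
  moreover have "e \<alpha> n < next_gap (seq_enat (f \<alpha>)) n" if "{n..e \<alpha> n} \<subseteq> range (f \<alpha>)" for n
  proof -
    have "\<exists>m\<ge>n. enat m \<notin> range (seq_enat (f \<alpha>))"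
      using f x by (intro ex_gap) auto
    from LeastI_ex[OF this] have "n \<le> next_gap (seq_enat (f \<alpha>)) n"
      "next_gap (seq_enat (f \<alpha>)) n \<notin> range (f \<alpha>)"
      by (auto simp: next_gap_def seq_enat_def)
    then show ?thesis using that by (meson atLeastAtMost_iff leI subsetD)
  qed
  ultimately have "\<forall>\<^sub>\<infinity>n. \<not> {n..e \<alpha> n} \<subseteq> range (f \<alpha>)"
    unfolding le_star_def by (elim MOST_mono) (meson leD)
  then show False using f[OF \<alpha>(1)] by (simp add: frequently_def)
qed

section \<open>The ultrafilter and the set \<open>X\<close>\<close>

theorem theorem4p6:
  assumes "regularCard frak_d"
  shows "\<exists>U f. set_ultrafilter U \<and> frak_b U = frak_d \<and> b_scale U f \<and>
           (let S = f ` Field frak_d in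
             (\<forall>k. B_property U (finite_power (X_space S) k)) \<and>
             \<not> Hurewicz (X_space S))"
proof -
  note d = Card_order_frak_d infinite_Field_frak_d
  obtain e where e: "dominating (e ` Field frak_d)"
    using dominating_indexed_by_frak_d by blast
  obtain f where f: "\<And>\<alpha>. strict_mono (f \<alpha>) \<and> infinite (- range (f \<alpha>)) \<and>
      (\<exists>\<^sub>\<infinity>n. {n..e \<alpha> n} \<subseteq> range (f \<alpha>))"
    and joint: "\<And>H. finite H \<Longrightarrow> H \<subseteq> Field frak_d \<Longrightarrow> infinite (joint_bound frak_d e f H)"
    using ex_scale[of e] by blast
  define C where "C H = joint_bound frak_d e f H" for H
  have "\<exists>U. set_ultrafilter U \<and> C ` Fpow (Field frak_d) \<subseteq> U"
  proof (rule ex_ultrafilter)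
    fix E assume "finite E" "E \<subseteq> C ` Fpow (Field frak_d)"
    then obtain \<H> where \<H>: "\<H> \<subseteq> Fpow (Field frak_d)" "finite \<H>" "E = C ` \<H>"
      using finite_subset_image by metis
    then have "infinite (C (\<Union>\<H>))"
      unfolding C_def by (intro joint) (auto simp: Fpow_def)
    moreover have "C (\<Union>\<H>) \<subseteq> \<Inter>E"
      unfolding \<H>(3) C_def joint_bound_def by blast
    ultimately show "infinite (\<Inter>E)" using infinite_super by blast
  qed
  then obtain U where ultra: "set_ultrafilter U" and CU: "\<And>H. H \<in> Fpow (Field frak_d) \<Longrightarrow> C H \<in> U"
    by blast
  have U: "set_filter U" using ultra unfolding set_ultrafilter_def by blast
  have below: "le_mod U (e \<alpha>) (f \<beta>)" "le_mod U (f \<alpha>) (f \<beta>)"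
    if "(\<alpha>, \<beta>) \<in> frak_d" "\<alpha> \<noteq> \<beta>" for \<alpha> \<beta>
  proof -
    have "C {\<alpha>, \<beta>} \<in> U" using that by (intro CU) (auto simp: Fpow_def Field_def)
    then show "le_mod U (e \<alpha>) (f \<beta>)" "le_mod U (f \<alpha>) (f \<beta>)"
      unfolding le_mod_def
      by (rule set_filter_mono[OF U], use that in \<open>auto simp: C_def joint_bound_def\<close>)+
  qed
  have "Well_order frak_d" using d(1) by (rule card_order_on_well_order_on)
  then have total: "total_on (Field frak_d) frak_d" and refl: "refl_on (Field frak_d) frak_d"
    by (auto simp: order_on_defs)
  have above: "\<exists>\<alpha>\<in>Field frak_d. \<forall>\<beta>\<in>Field frak_d. (\<beta>, \<alpha>) \<notin> frak_d \<longrightarrow> le_mod U g (f \<beta>)" for g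
  proof -
    obtain \<alpha> where \<alpha>: "\<alpha> \<in> Field frak_d" "le_star g (e \<alpha>)"
      using e unfolding dominating_def by blast
    have "le_mod U g (f \<beta>)" if "\<beta> \<in> Field frak_d" "(\<beta>, \<alpha>) \<notin> frak_d" for \<beta>
    proof -
      have "\<alpha> \<noteq> \<beta>" using that refl by (auto simp: refl_on_def)
      then have "(\<alpha>, \<beta>) \<in> frak_d" using that \<alpha>(1) total by (auto simp: total_on_def)
      then show ?thesis
        using below(1) \<open>\<alpha> \<noteq> \<beta>\<close> \<alpha>(2) le_star_imp_le_mod[OF U] le_mod_trans[OF U] by blast
    qed
    then show ?thesis using \<alpha>(1) by blast
  qed
  have cofinal: "\<exists>\<beta>\<in>Field frak_d. le_mod U g (f \<beta>)" for g
  proof -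
    obtain \<alpha> where \<alpha>: "\<alpha> \<in> Field frak_d" "le_star g (e \<alpha>)"
      using e unfolding dominating_def by blast
    \<comment> \<open>An infinite cardinal has no last index.\<close>
    obtain \<beta> where "\<beta> \<in> Field frak_d" "\<alpha> \<noteq> \<beta>" "(\<alpha>, \<beta>) \<in> frak_d"
      using infinite_Card_order_limit[OF d \<alpha>(1)] by blast
    then show ?thesis
      using below(1) \<alpha>(2) le_star_imp_le_mod[OF U] le_mod_trans[OF U] by blast
  qed
  have unbounded: "\<not> bounded_wrt (le_mod U) (f ` Field frak_d)"
  proof
    assume "bounded_wrt (le_mod U) (f ` Field frak_d)"
    then obtain g where g: "\<And>\<alpha>. \<alpha> \<in> Field frak_d \<Longrightarrow> le_mod U (f \<alpha>) g"
      unfolding bounded_wrt_def by blast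
    \<comment> \<open>Cofinality applied to \<open>g + 1\<close> puts the empty set
      \<open>{n. Suc (g n) \<le> g n}\<close> into \<open>U\<close>.\<close>
    obtain \<alpha> where "\<alpha> \<in> Field frak_d" "le_mod U (\<lambda>n. Suc (g n)) (f \<alpha>)" using cofinal by blast
    then have "le_mod U (\<lambda>n. Suc (g n)) g" using g le_mod_trans[OF U] by blast
    then show False using set_filter_infinite[OF U] by (force simp: le_mod_def)
  qed
  have small_bounded: "bounded_wrt (le_mod U) Y" if Y: "|Y| <o frak_d" for Y
  proof -
    \<comment> \<open>These sets increase with \<open>\<alpha>\<close> and cover \<open>Y\<close> by
      cofinality; regularity places the small set \<open>Y\<close> inside a single one.\<close>
    define As where "As \<alpha> = {y. \<exists>\<beta>. (\<beta>, \<alpha>) \<in> frak_d \<and> le_mod U y (f \<beta>)}" for \<alpha>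
    have "trans frak_d" using \<open>Well_order frak_d\<close> by (auto simp: order_on_defs)
    then have "relChain frak_d As"
      unfolding relChain_def As_def by (auto dest: transD)
    moreover have "Y \<subseteq> (\<Union>\<alpha>\<in>Field frak_d. As \<alpha>)"
    proof
      fix y assume "y \<in> Y"
      obtain \<alpha> where "\<alpha> \<in> Field frak_d" "le_mod U y (f \<alpha>)" using cofinal by blast
      then show "y \<in> (\<Union>\<alpha>\<in>Field frak_d. As \<alpha>)"
        using refl unfolding As_def refl_on_def by blast
    qed
    ultimately obtain \<alpha> where \<alpha>: "\<alpha> \<in> Field frak_d" "Y \<subseteq> As \<alpha>"
      using regularCard_UNION[OF d(1) assms] Y by blast
    have "le_mod U y (f \<alpha>)" if "y \<in> Y" for y
    proof -
      obtain \<beta> where "(\<beta>, \<alpha>) \<in> frak_d" "le_mod U y (f \<beta>)" using \<alpha>(2) \<open>y \<in> Y\<close> unfolding As_def by blast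
      then show ?thesis using below(2) le_mod_trans[OF U] by blast
    qed
    then show ?thesis unfolding bounded_wrt_def by blast
  qed
  have "frak_b U =o frak_d"
  proof -
    let ?Y = "{Y. \<not> bounded_wrt (le_mod U) Y}"
    have ne: "?Y \<noteq> {}" using unbounded by blast
    have "frak_b U \<le>o |f ` Field frak_d|"
      unfolding frak_b_def using unbounded by (intro min_card(3)[OF ne]) simp
    also have "|f ` Field frak_d| \<le>o |Field frak_d|" by (rule card_of_image)
    also have "|Field frak_d| =o frak_d" using card_of_Field_ordIso[OF d(1)] .
    finally have "frak_b U \<le>o frak_d" .
    moreover have "frak_d \<le>o frak_b U"
    proof -
      obtain Y where Y: "\<not> bounded_wrt (le_mod U) Y" "frak_b U =o |Y|"
        using min_card(2)[OF ne] unfolding frak_b_def by blast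
      then have "\<not> |Y| <o frak_d" using small_bounded by blast
      then have "frak_d \<le>o |Y|"
        using ordLess_or_ordLeq[OF card_of_Well_order \<open>Well_order frak_d\<close>] by blast
      then show ?thesis using Y(2) ordIso_symmetric ordLeq_ordIso_trans by blast
    qed
    ultimately show ?thesis by (simp add: ordIso_iff_ordLeq)
  qed
  \<comment> \<open>\<open>min_card\<close> depends only on the minimal cardinality, which turns the
    isomorphism into an equality.\<close>
  then have b_eq_d: "frak_b U = frak_d"
    unfolding frak_b_def frak_d_def using unbounded dominating_UNIV
    by (subst min_card_eq_iff) auto
  have scale: "b_scale U f"
    unfolding b_scale_def b_eq_d using f unbounded below(2) by blast
  have "B_property U (finite_power (X_space (f ` Field frak_d)) k)" for k
    unfolding finite_power_def
  proof (rule B_property_power[OF U])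
    fix g
    obtain \<alpha> where \<alpha>: "\<alpha> \<in> Field frak_d"
      "\<And>\<beta>. \<beta> \<in> Field frak_d \<Longrightarrow> (\<beta>, \<alpha>) \<notin> frak_d \<Longrightarrow> le_mod U g (f \<beta>)"
      using above by blast
    \<comment> \<open>Exceptional elements have indices at or below \<open>\<alpha>\<close>, and a
      proper initial segment of a cardinal is smaller than it.\<close>
    have "{s \<in> f ` Field frak_d. \<not> le_mod U g s} \<subseteq> f ` (underS frak_d \<alpha> \<union> {\<alpha>})"
      using \<alpha>(2) by (auto simp: underS_def)
    then have "|{s \<in> f ` Field frak_d. \<not> le_mod U g s}| \<le>o |f ` (underS frak_d \<alpha> \<union> {\<alpha>})|"
      by (rule card_of_mono1)
    also have "|f ` (underS frak_d \<alpha> \<union> {\<alpha>})| \<le>o |underS frak_d \<alpha> \<union> {\<alpha>}|" by (rule card_of_image)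
    also have "|underS frak_d \<alpha> \<union> {\<alpha>}| <o frak_d"
      using card_of_underS[OF d(1) \<alpha>(1)] card_of_finite_ordLess[OF _ d, of "{\<alpha>}"]
      by (intro card_of_Un_ordLess_infinite_Field[OF d(2,1)]) auto
    finally show "|{s \<in> f ` Field frak_d. \<not> le_mod U g s}| <o frak_b U"
      unfolding b_eq_d .
  qed (use f in auto)
  moreover have "\<not> Hurewicz (X_space (f ` Field frak_d))"
    using f by (intro not_Hurewicz_gaps[OF e]) auto
  ultimately show ?thesis using ultra b_eq_d scale unfolding Let_def by blast
qed

end
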